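(* Let $0<p<1$ and let $X$ have the geometric distribution with parameter $p$, whose range is the set of positive integers, with probability mass function $f(x)=(1-p)^{x-1}p$. Then the first-order, complementary and second-order loss functions of $X$, as functions of $r$, are $$L_1(r)=\frac{(1-p)^r}{p},\qquad L_c(r)=\frac{(1-p)^r+pr-1}{p},\qquad L_2(r)=\frac{(1-p)^{r+1}}{p^2}.$$
   Context: For a discrete random variable $X$ with probability mass function $f$ (defined on the range of $X$), the first-order loss function is $L_1(r)=\mathbb{E}[[X-r]^+]=\sum_{x\ge r}(x-r)f(x)$, the complementary loss function is $L_c(r)=\mathbb{E}[[X-r]^-]=\sum_{x\le r}(r-x)f(x)$, and the second-order loss function is $L_2(r)=\frac12\mathbb{E}[[X-r]^+[X-r-1]^+]=\frac12\sum_{x\ge r}(x-r)(x-r-1)f(x)$, the sums running over $x$ in the range of $X$. Here $[y]^+=\max(y,0)$ and $[y]^-=\max(-y,0)$.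
   Formalization: The formulas are stated for non-negative integers r only; they fail for other r, e.g. for r = -1 and p = 1/2 one has L_1(r) = 3 while the formula gives 4, and for non-integer r > 0 the function L_1 is piecewise linear. *)

theory Defs
  imports "HOL-Probability.Probability"
begin

definition pos_part :: "real \<Rightarrow> real" where
  "pos_part y = max y 0"

definition neg_part :: "real \<Rightarrow> real" where
  "neg_part y = max (- y) 0"

definition loss_first :: "'a measure \<Rightarrow> ('a \<Rightarrow> real) \<Rightarrow> real \<Rightarrow> real" where
  "loss_first M X r = (LINT \<omega>|M. pos_part (X \<omega> - r))"

definition loss_compl :: "'a measure \<Rightarrow> ('a \<Rightarrow> real) \<Rightarrow> real \<Rightarrow> real" where
  "loss_compl M X r = (LINT \<omega>|M. neg_part (X \<omega> - r))"

definition loss_second :: "'a measure \<Rightarrow> ('a \<Rightarrow> real) \<Rightarrow> real \<Rightarrow> real" where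
  "loss_second M X r = 1 / 2 * (LINT \<omega>|M. pos_part (X \<omega> - r) * pos_part (X \<omega> - r - 1))"

text \<open>
  A random variable with range \<open>{1..}\<close> whose probability mass function is the density
  with respect to counting measure. (The library's \<open>geometric_pmf\<close> starts at 0 instead.)
\<close>
definition geometric_distributed :: "'a measure \<Rightarrow> ('a \<Rightarrow> nat) \<Rightarrow> real \<Rightarrow> bool" where
  "geometric_distributed M X p \<longleftrightarrow>
     distributed M (count_space {1..}) X (\<lambda>x. ennreal ((1 - p) ^ (x - 1) * p))"

text \<open>
  The expectations above are the usual sums against the mass function. For the second-order
  loss this needs \<open>r\<close> to be an integer: otherwise a value strictly between \<open>r\<close> and \<open>r + 1\<close>
  contributes a negative term to the sum.
\<close>
lemma loss_sums:
  fixes X :: "'a \<Rightarrow> nat" and f :: "nat \<Rightarrow> real" and r :: nat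
  assumes X: "distributed M (count_space S) X (\<lambda>x. ennreal (f x))"
    and f: "\<And>x. x \<in> S \<Longrightarrow> 0 \<le> f x"
  shows "loss_first M (\<lambda>\<omega>. real (X \<omega>)) (real r) =
      (\<Sum>\<^sub>ax\<in>{x\<in>S. x \<ge> r}. (real x - real r) * f x)"
    and "loss_compl M (\<lambda>\<omega>. real (X \<omega>)) (real r) =
      (\<Sum>\<^sub>ax\<in>{x\<in>S. x \<le> r}. (real r - real x) * f x)"
    and "loss_second M (\<lambda>\<omega>. real (X \<omega>)) (real r) =
      1 / 2 * (\<Sum>\<^sub>ax\<in>{x\<in>S. x \<ge> r}. (real x - real r) * (real x - real r - 1) * f x)"
proof -
  have E: "(LINT \<omega>|M. g (X \<omega>)) = (\<Sum>\<^sub>ax\<in>S. f x * g x)" for g :: "nat \<Rightarrow> real"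
    using distributed_integral[OF X, of g] f by (simp add: infsetsum_def)
  show "loss_first M (\<lambda>\<omega>. real (X \<omega>)) (real r) =
      (\<Sum>\<^sub>ax\<in>{x\<in>S. x \<ge> r}. (real x - real r) * f x)"
    unfolding loss_first_def E[of "\<lambda>x. pos_part (real x - real r)"]
    by (rule infsetsum_cong_neutral) (auto simp: pos_part_def)
  show "loss_compl M (\<lambda>\<omega>. real (X \<omega>)) (real r) =
      (\<Sum>\<^sub>ax\<in>{x\<in>S. x \<le> r}. (real r - real x) * f x)"
    unfolding loss_compl_def E[of "\<lambda>x. neg_part (real x - real r)"]
    by (rule infsetsum_cong_neutral) (auto simp: neg_part_def)
  have "pos_part (real x - real r) * pos_part (real x - real r - 1) =
      (real x - real r) * (real x - real r - 1)" if "x \<ge> r" for x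
    using that by (cases "x = r") (auto simp: pos_part_def)
  then have "(\<Sum>\<^sub>ax\<in>S. f x * (pos_part (real x - real r) * pos_part (real x - real r - 1))) =
      (\<Sum>\<^sub>ax\<in>{x\<in>S. x \<ge> r}. (real x - real r) * (real x - real r - 1) * f x)"
    by (intro infsetsum_cong_neutral) (auto simp: pos_part_def)
  then show "loss_second M (\<lambda>\<omega>. real (X \<omega>)) (real r) =
      1 / 2 * (\<Sum>\<^sub>ax\<in>{x\<in>S. x \<ge> r}. (real x - real r) * (real x - real r - 1) * f x)"
    unfolding loss_second_def
      E[of "\<lambda>x. pos_part (real x - real r) * pos_part (real x - real r - 1)"] by simp
qed

end

theory Submission imports Defs begin

text \<open>Put \<open>q = 1 - p\<close>. By \<open>loss_sums\<close> each loss is a sum against the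
  mass function. The two infinite sums are shifted past their vanishing terms, which pulls out a
  power of \<open>q\<close>: the substitution \<open>x = r + 1 + k\<close> leaves the series of
  \<open>(k + 1) * q ^ k\<close>, equal to \<open>1 / p ^ 2\<close>, and
  \<open>x = r + 2 + k\<close> leaves twice the series in \<open>triangular_geometric_sums\<close>,
  equal to \<open>1 / p ^ 3\<close>. The complementary loss is a finite sum, evaluated by induction
  on \<open>r\<close> in \<open>sum_geometric_shortfall\<close>.\<close>

text \<open>Nonnegative terms make the convergent shifted series absolutely summable, so the
  unordered sum agrees with the ordered one.\<close>

lemma infsetsum_atLeast_eqI:
  fixes f :: "nat \<Rightarrow> real"
  assumes "\<And>k. 0 \<le> f (n + k)" and "(\<lambda>k. f (n + k)) sums s"
  shows "(\<Sum>\<^sub>ax\<in>{n..}. f x) = s"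
proof -
  have "bij_betw (\<lambda>k. n + k) UNIV {n..}"
    by (rule bij_betwI[where g = "\<lambda>x. x - n"]) auto
  then have "(\<Sum>\<^sub>ax\<in>{n..}. f x) = (\<Sum>\<^sub>ak. f (n + k))"
    by (rule infsetsum_reindex_bij_betw[symmetric])
  also have "\<dots> = (\<Sum>k. f (n + k))"
    using assms by (intro infsetsum_nat')
      (simp add: abs_summable_on_nat_iff' sums_iff)
  also have "\<dots> = s"
    using assms(2) by (simp add: sums_iff)
  finally show ?thesis .
qed

text \<open>Cauchy product of the series for \<open>1 / (1 - q) ^ 2\<close> and
  \<open>1 / (1 - q)\<close>: the coefficient of \<open>q ^ k\<close> is
  \<open>1 + ... + (k + 1)\<close>, a triangular number.\<close>

lemma triangular_geometric_sums:
  fixes q :: real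
  assumes "\<bar>q\<bar> < 1"
  shows "(\<lambda>k. real (k + 1) * real (k + 2) / 2 * q ^ k) sums (1 / (1 - q) ^ 3)"
proof -
  have d: "(\<lambda>k. real (Suc k) * q ^ k) sums (1 / (1 - q)\<^sup>2)"
    using assms by (intro geometric_deriv_sums) simp
  have g: "(\<lambda>k. q ^ k) sums (1 / (1 - q))"
    using assms by (intro geometric_sums) simp
  have "summable (\<lambda>k. \<bar>q\<bar> ^ k)" "summable (\<lambda>k. real (Suc k) * \<bar>q\<bar> ^ k)"
    using geometric_sums[of "\<bar>q\<bar>"] geometric_deriv_sums[of "\<bar>q\<bar>"] assms
    by (auto simp: sums_iff)
  then have "summable (\<lambda>k. norm (real (Suc k) * q ^ k))" "summable (\<lambda>k. norm (q ^ k))"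
    by (simp_all add: abs_mult power_abs)
  from Cauchy_product_sums[OF this]
  have "(\<lambda>k. \<Sum>i\<le>k. real (Suc i) * q ^ i * q ^ (k - i)) sums (1 / (1 - q)\<^sup>2 * (1 / (1 - q)))"
    using d g by (simp only: sums_iff)
  moreover have "(\<Sum>i\<le>k. real (Suc i) * q ^ i * q ^ (k - i)) =
      real (k + 1) * real (k + 2) / 2 * q ^ k" for k
  proof -
    have "(\<Sum>i\<le>k. real (Suc i) * q ^ i * q ^ (k - i)) = (\<Sum>i\<le>k. real (Suc i)) * q ^ k"
      by (simp add: sum_distrib_right mult.assoc flip: power_add)
    also have "(\<Sum>i\<le>k. real (Suc i)) = real (k + 1) * real (k + 2) / 2"
      by (induction k) (auto simp: field_simps)
    finally show ?thesis .
  qed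
  moreover have "1 / (1 - q)\<^sup>2 * (1 / (1 - q)) = 1 / (1 - q) ^ 3"
    by (simp add: power2_eq_square power3_eq_cube)
  ultimately show ?thesis
    by (simp only:)
qed

text \<open>Raising \<open>r\<close> by one adds one to each shortfall \<open>r - x\<close>, so the
  sum grows by the geometric mass \<open>1 - q ^ r\<close> of \<open>{1..r}\<close>. The outer
  factor \<open>1 - q\<close> keeps the identity polynomial in \<open>q\<close>.\<close>

lemma sum_geometric_shortfall:
  fixes q :: real
  shows "(1 - q) * (\<Sum>x=1..r. (real r - real x) * q ^ (x - 1) * (1 - q)) =
    q ^ r + (1 - q) * real r - 1"
proof (induction r)
  case (Suc r)
  have "(1 - q) * (\<Sum>x=1..r. q ^ (x - 1)) = 1 - q ^ r"
    by (simp add: sum.atLeast1_atMost_eq one_diff_power_eq)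
  \<comment> \<open>The new summand \<open>x = Suc r\<close> has shortfall zero.\<close>
  moreover have "(\<Sum>x=1..Suc r. (real (Suc r) - real x) * q ^ (x - 1) * (1 - q)) =
      (\<Sum>x=1..r. (real r - real x) * q ^ (x - 1) * (1 - q)) +
      (1 - q) * (\<Sum>x=1..r. q ^ (x - 1))"
    by (simp add: sum_distrib_left algebra_simps flip: sum.distrib)
  ultimately have "(1 - q) * (\<Sum>x=1..Suc r. (real (Suc r) - real x) * q ^ (x - 1) * (1 - q)) =
      (q ^ r + (1 - q) * real r - 1) + (1 - q) * (1 - q ^ r)"
    using Suc.IH by (simp only: distrib_left)
  then show ?case
    by (simp add: algebra_simps)
qed simp

theorem mainTheorem2:
  fixes M :: "'a measure" and X :: "'a \<Rightarrow> nat" and p :: real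
  assumes "prob_space M"
    and "0 < p" and "p < 1"
    and "geometric_distributed M X p"
  shows "\<forall>r::nat.
      loss_first M (\<lambda>\<omega>. real (X \<omega>)) (real r) = (1 - p) ^ r / p \<and>
      loss_compl M (\<lambda>\<omega>. real (X \<omega>)) (real r) = ((1 - p) ^ r + p * real r - 1) / p \<and>
      loss_second M (\<lambda>\<omega>. real (X \<omega>)) (real r) = (1 - p) ^ (r + 1) / p ^ 2"
proof (intro allI conjI)
  fix r :: nat
  define f where "f x = (1 - p) ^ (x - 1) * p" for x :: nat
  have f: "0 \<le> f x" for x
    using assms(2,3) by (simp add: f_def)
  have X: "distributed M (count_space {1..}) X (\<lambda>x. ennreal (f x))"
    using assms(4) by (simp add: geometric_distributed_def f_def)
  note loss = loss_sums[OF X f, of r]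

  \<comment> \<open>Starting at \<open>Suc r\<close> drops only a zero term at \<open>x = r\<close>,
    and nothing when \<open>r = 0\<close>, since the range begins at 1. There the truncated exponent
    \<open>x - 1\<close> is simply \<open>r + k\<close>.\<close>
  have "(\<lambda>k. (1 - p) ^ r * p * (real (Suc k) * (1 - p) ^ k)) sums
      ((1 - p) ^ r * p * (1 / (1 - (1 - p))\<^sup>2))"
    using assms(2,3) by (intro sums_mult geometric_deriv_sums) simp
  then have "(\<lambda>k. (real (Suc r + k) - real r) * f (Suc r + k)) sums ((1 - p) ^ r / p)"
    using assms(2) by (simp add: f_def power_add power2_eq_square mult_ac add_ac)
  then have "(\<Sum>\<^sub>ax\<in>{Suc r..}. (real x - real r) * f x) = (1 - p) ^ r / p"
    using f by (intro infsetsum_atLeast_eqI) auto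
  moreover have "(\<Sum>\<^sub>ax\<in>{x\<in>{1..}. x \<ge> r}. (real x - real r) * f x) =
      (\<Sum>\<^sub>ax\<in>{Suc r..}. (real x - real r) * f x)"
    by (rule infsetsum_cong_neutral) auto
  ultimately show "loss_first M (\<lambda>\<omega>. real (X \<omega>)) (real r) = (1 - p) ^ r / p"
    using loss(1) by simp

  have "{x \<in> {1..}. x \<le> r} = {1..r}"
    by auto
  then have "loss_compl M (\<lambda>\<omega>. real (X \<omega>)) (real r) = (\<Sum>x=1..r. (real r - real x) * f x)"
    using loss(2) by simp
  then show "loss_compl M (\<lambda>\<omega>. real (X \<omega>)) (real r) = ((1 - p) ^ r + p * real r - 1) / p"
    using sum_geometric_shortfall[of "1 - p" r] assms(2)
    by (simp add: f_def field_simps)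

  \<comment> \<open>At \<open>x = r + 2 + k\<close> the weight is \<open>(k + 2) * (k + 1)\<close>,
    twice a triangular number; this 2 later cancels the \<open>1 / 2\<close> of the second-order
    loss.\<close>
  have "(\<lambda>k. 2 * (1 - p) ^ (r + 1) * p * (real (k + 1) * real (k + 2) / 2 * (1 - p) ^ k)) sums
      (2 * (1 - p) ^ (r + 1) * p * (1 / (1 - (1 - p)) ^ 3))"
    using assms(2,3) by (intro sums_mult triangular_geometric_sums) simp
  moreover have "2 * (1 - p) ^ (r + 1) * p * (real (k + 1) * real (k + 2) / 2 * (1 - p) ^ k) =
      (real (r + 2 + k) - real r) * (real (r + 2 + k) - real r - 1) * f (r + 2 + k)" for k
    by (simp add: f_def power_add field_simps)
  moreover have "2 * (1 - p) ^ (r + 1) * p * (1 / (1 - (1 - p)) ^ 3) = 2 * ((1 - p) ^ (r + 1) / p\<^sup>2)"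
    using assms(2) by (simp add: power2_eq_square power3_eq_cube)
  ultimately have "(\<lambda>k. (real (r + 2 + k) - real r) * (real (r + 2 + k) - real r - 1) * f (r + 2 + k))
      sums (2 * ((1 - p) ^ (r + 1) / p\<^sup>2))"
    by (simp only:)
  then have "(\<Sum>\<^sub>ax\<in>{r + 2..}. (real x - real r) * (real x - real r - 1) * f x) =
      2 * ((1 - p) ^ (r + 1) / p\<^sup>2)"
    using f by (intro infsetsum_atLeast_eqI) auto
  \<comment> \<open>The only points dropped are \<open>r\<close> and \<open>r + 1\<close>, the two
    roots of the weight.\<close>
  moreover have "(\<Sum>\<^sub>ax\<in>{x\<in>{1..}. x \<ge> r}. (real x - real r) * (real x - real r - 1) * f x) =
      (\<Sum>\<^sub>ax\<in>{r + 2..}. (real x - real r) * (real x - real r - 1) * f x)"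
  proof (rule infsetsum_cong_neutral)
    fix x assume "x \<in> {x\<in>{1..}. x \<ge> r} - {r + 2..}"
    then have "x = r \<or> x = r + 1"
      by auto
    then show "(real x - real r) * (real x - real r - 1) * f x = 0"
      by auto
  qed auto
  ultimately show "loss_second M (\<lambda>\<omega>. real (X \<omega>)) (real r) = (1 - p) ^ (r + 1) / p ^ 2"
    using loss(3) by simp
qed

end
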